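(* Let $X$ be a Banach space, $\{K_n: n\in\mathbb N\}$ a partition of $\mathbb N$, $\mathcal I_n$ an ideal on $K_n$ for each $n\in\mathbb N$ and $\mathcal I=\bigoplus_{n\in\mathbb N}\mathcal I_n$. Then $c_{0,\mathcal I^\perp}(X)$ is isometric to $c_0((c_{0,\mathcal I_j^\perp}(X))_{j\in\mathbb N})$. In particular, $c_{0,\mathcal J^{\omega\perp}}(X)$ is isometric to $c_0(c_{0,\mathcal J^\perp}(X))$ for any ideal $\mathcal J$ on $\mathbb N$.
   Context: An ideal on a set $S$ is a collection of subsets of $S$ containing $\emptyset$, closed under taking subsets and under finite unions; it is always assumed to contain every finite subset of $S$ (it need not be proper). For an ideal $\mathcal I$ on a countable set $S$, its orthogonal is $\mathcal I^\perp=\{B\subseteq S: A\cap B\text{ is finite for all }A\in\mathcal I\}$ (so $\mathcal I_j^\perp$ is taken within $K_j$). For an ideal $\mathcal I$ on a countable set $S$ and a Banach space $X$, $c_{0,\mathcal I}(X)$ is the space of bounded families $(x_s)_{s\in S}$ in $X$ such that $\{s\in S:\|x_s\|\ge\varepsilon\}\in\mathcal I$ for every $\varepsilon>0$, with the sup norm. $\bigoplus_n\mathcal I_n$ is the ideal on $\mathbb N$ given by $A\in\bigoplus_n\mathcal I_n$ iff $A\cap K_n\in\mathcal I_n$ for all $n$. $\mathcal J^\omega$ denotes $\bigoplus_n\mathcal J_n'$ where $\{K_n:n\in\mathbb N\}$ is a partition of $\mathbb N$ into infinite sets and $\mathcal J_n'$ is an isomorphic copy of $\mathcal J$ on $K_n$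 (transported by a bijection); up to isomorphism it does not depend on the choices. $\mathcal J^{\omega\perp}=(\mathcal J^\omega)^\perp$. $c_0((X_j)_{j\in\mathbb N})$ is the space of sequences $(x_j)\in\prod_jX_j$ with $\lim_j\|x_j\|=0$, with norm $\sup_j\|x_j\|$; $c_0(X)$ is the case $X_j=X$ for all $j$. Isometric means there is a surjective linear isometry. *)

theory Defs
  imports "HOL-Analysis.Analysis" "HOL-Library.Disjoint_Sets"
begin

definition ideal_on :: "'s set \<Rightarrow> 's set set \<Rightarrow> bool" where
  "ideal_on S \<I> \<longleftrightarrow>
     \<I> \<subseteq> Pow S \<and> {} \<in> \<I> \<and>
     (\<forall>A\<in>\<I>. \<forall>B. B \<subseteq> A \<longrightarrow> B \<in> \<I>) \<and>
     (\<forall>A\<in>\<I>. \<forall>B\<in>\<I>. A \<union> B \<in> \<I>) \<and>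
     (\<forall>F. F \<subseteq> S \<and> finite F \<longrightarrow> F \<in> \<I>)"

definition orth_ideal :: "'s set \<Rightarrow> 's set set \<Rightarrow> 's set set" where
  "orth_ideal S \<I> = {B. B \<subseteq> S \<and> (\<forall>A\<in>\<I>. finite (A \<inter> B))}"

definition indexed_partition :: "(nat \<Rightarrow> nat set) \<Rightarrow> bool" where
  "indexed_partition K \<longleftrightarrow> inj K \<and> partition_on UNIV (range K)"

definition ideal_sum :: "(nat \<Rightarrow> nat set) \<Rightarrow> (nat \<Rightarrow> nat set set) \<Rightarrow> nat set set" where
  "ideal_sum K \<I> = {A. \<forall>n. A \<inter> K n \<in> \<I> n}"

definition ideal_copy :: "nat set set \<Rightarrow> nat set \<Rightarrow> nat set set \<Rightarrow> bool" where
  "ideal_copy \<J> S \<J>' \<longleftrightarrow> (\<exists>f. bij_betw f (UNIV :: nat set) S \<and> \<J>' = (\<lambda>A. f ` A) ` \<J>)"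

text \<open>The ideal \<open>\<J>\<^sup>\<omega>\<close> depends on the choice of a partition into infinite sets and of
  isomorphic copies of \<open>\<J>\<close>, and is determined only up to isomorphism. The predicate holds
  for the result of every such choice.\<close>

definition omega_power :: "nat set set \<Rightarrow> nat set set \<Rightarrow> bool" where
  "omega_power \<J> \<J>\<omega> \<longleftrightarrow>
     (\<exists>K \<J>'. indexed_partition K \<and> (\<forall>n. infinite (K n)) \<and>
        (\<forall>n. ideal_copy \<J> (K n) (\<J>' n)) \<and> \<J>\<omega> = ideal_sum K \<J>')"

text \<open>Since \<open>nat\<close> is discrete, the type \<open>nat \<Rightarrow>\<^sub>C 'a\<close> consists of all bounded sequences, with
  the supremum norm. A bounded family indexed by a set \<open>S\<close> of natural numbers is represented
  by its extension by zero; this preserves the vector operations and the supremum norm.\<close>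

definition c0_ideal :: "nat set \<Rightarrow> nat set set \<Rightarrow> (nat \<Rightarrow>\<^sub>C 'a::banach) set" where
  "c0_ideal S \<I> =
     {x. (\<forall>s. s \<notin> S \<longrightarrow> apply_bcontfun x s = 0) \<and>
         (\<forall>\<epsilon>>0. {s\<in>S. norm (apply_bcontfun x s) \<ge> \<epsilon>} \<in> \<I>)}"

text \<open>The \<open>c\<^sub>0\<close>-sum of a sequence of subspaces of one ambient normed space. Sequences whose
  norms tend to 0 are bounded, so nothing is lost by working in \<open>nat \<Rightarrow>\<^sub>C 'b\<close>.\<close>

definition c0_sum :: "(nat \<Rightarrow> 'b::real_normed_vector set) \<Rightarrow> (nat \<Rightarrow>\<^sub>C 'b) set" where
  "c0_sum X =
     {x. (\<forall>j. apply_bcontfun x j \<in> X j) \<and>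
         (\<lambda>j. norm (apply_bcontfun x j)) \<longlonglongrightarrow> 0}"

text \<open>Surjective linear isometry between linear subspaces \<open>V\<close> and \<open>W\<close>.\<close>

definition isometric_spaces ::
    "'a::real_normed_vector set \<Rightarrow> 'b::real_normed_vector set \<Rightarrow> bool" where
  "isometric_spaces V W \<longleftrightarrow>
     (\<exists>T. (\<forall>x\<in>V. \<forall>y\<in>V. T (x + y) = T x + T y) \<and>
          (\<forall>c. \<forall>x\<in>V. T (c *\<^sub>R x) = c *\<^sub>R T x) \<and>
          (\<forall>x\<in>V. norm (T x) = norm x) \<and>
          T ` V = W)"

end

theory Submission imports Defs begin

text \<open>A set \<open>B\<close> is orthogonal to \<open>\<Oplus>\<^sub>n \<I>\<^sub>n\<close> iff it meets only finitely many \<open>K\<^sub>n\<close> and each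
  \<open>B \<inter> K\<^sub>n\<close> is orthogonal to \<open>\<I>\<^sub>n\<close>: a selector of the blocks met by \<open>B\<close> belongs to
  \<open>\<Oplus>\<^sub>n \<I>\<^sub>n\<close>, so it has to be finite. Hence restricting a family to the blocks is the required
  isometry, the finiteness condition being exactly that the norms of the restrictions tend
  to 0. Both claims of the theorem are covered at once by allowing each block \<open>K\<^sub>j\<close> to be
  reindexed by a bijection from a set \<open>S\<^sub>j\<close>.\<close>

section \<open>Orthogonals of direct sums of ideals\<close>

lemma indexed_partition_disjoint:
  assumes "indexed_partition K" "n \<in> K i" "n \<in> K j"
  shows "i = j"
  using assms
  by (auto simp: indexed_partition_def partition_on_def disjoint_def inj_def) blast

lemma indexed_partition_cover:
  assumes "indexed_partition K"
  obtains j where "n \<in> K j"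
  using assms by (auto simp: indexed_partition_def partition_on_def)

lemma orth_ideal_sum_iff:
  assumes K: "indexed_partition K" and \<I>: "\<And>n. ideal_on (K n) (\<I> n)"
  shows "B \<in> orth_ideal UNIV (ideal_sum K \<I>) \<longleftrightarrow>
    finite {n. B \<inter> K n \<noteq> {}} \<and> (\<forall>n. B \<inter> K n \<in> orth_ideal (K n) (\<I> n))"
    (is "?L \<longleftrightarrow> finite ?N \<and> ?R")
proof (intro iffI conjI)
  assume L: ?L
  show ?R
  proof (clarsimp simp: orth_ideal_def)
    fix n A assume A: "A \<in> \<I> n"
    have AK: "A \<subseteq> K n" using \<I>[of n] A by (auto simp: ideal_on_def)
    \<comment> \<open>\<open>A\<close> itself lies in the direct sum, its trace on every other block
      being empty; testing \<open>B\<close> against it settles block \<open>n\<close>.\<close>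
    have "A \<inter> K m \<in> \<I> m" for m
    proof (cases "m = n")
      case True
      then show ?thesis using A AK by (simp add: Int_absorb2)
    next
      case False
      then have "A \<inter> K m = {}" using AK indexed_partition_disjoint[OF K] by blast
      then show ?thesis using \<I>[of m] by (simp add: ideal_on_def)
    qed
    then have "finite (A \<inter> B)" using L by (auto simp: orth_ideal_def ideal_sum_def)
    then show "finite (A \<inter> (B \<inter> K n))" by (rule rev_finite_subset) auto
  qed
  \<comment> \<open>The selector: one point of \<open>B\<close> from each block that
    \<open>B\<close> meets. Its trace on a block has at most one point, and ideals contain all
    finite sets, so it lies in the direct sum.\<close>
  obtain c where c: "\<And>n. n \<in> ?N \<Longrightarrow> c n \<in> B \<inter> K n"
    using bchoice[of ?N "\<lambda>n b. b \<in> B \<inter> K n"] by blast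
  have "c ` ?N \<inter> K m \<in> \<I> m" for m
  proof -
    have "c ` ?N \<inter> K m \<subseteq> {c m}"
      using c indexed_partition_disjoint[OF K] by blast
    then have "finite (c ` ?N \<inter> K m)" by (rule finite_subset) simp
    then show ?thesis using \<I>[of m] by (simp add: ideal_on_def)
  qed
  then have "finite (c ` ?N \<inter> B)" using L by (auto simp: orth_ideal_def ideal_sum_def)
  moreover have "c ` ?N \<inter> B = c ` ?N" using c by blast
  moreover have "inj_on c ?N"
    by (rule inj_onI) (metis IntE c indexed_partition_disjoint[OF K])
  ultimately show "finite ?N" by (simp add: finite_image_iff)
next
  assume R: "finite ?N \<and> ?R"
  show ?L
  proof (clarsimp simp: orth_ideal_def ideal_sum_def)
    fix A assume A: "\<forall>n. A \<inter> K n \<in> \<I> n"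
    have "A \<inter> B \<subseteq> (\<Union>n\<in>?N. (A \<inter> K n) \<inter> (B \<inter> K n))"
    proof
      fix x assume x: "x \<in> A \<inter> B"
      obtain j where "x \<in> K j" using indexed_partition_cover[OF K] .
      then show "x \<in> (\<Union>n\<in>?N. (A \<inter> K n) \<inter> (B \<inter> K n))" using x by blast
    qed
    moreover have "finite ((A \<inter> K n) \<inter> (B \<inter> K n))" for n
      using R A by (auto simp: orth_ideal_def)
    ultimately show "finite (A \<inter> B)" using R by (meson finite_UN_I finite_subset)
  qed
qed

section \<open>Transport of ideals along bijections\<close>

lemma ideal_on_image:
  assumes "bij_betw f S T" "ideal_on S \<J>"
  shows "ideal_on T ((`) f ` \<J>)"
  unfolding ideal_on_def
proof (intro conjI ballI allI impI)
  have T: "T = f ` S" using assms(1) by (auto simp: bij_betw_def)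
  show "(`) f ` \<J> \<subseteq> Pow T" "{} \<in> (`) f ` \<J>"
    using assms(2) by (auto simp: ideal_on_def T)
  fix A assume "A \<in> (`) f ` \<J>"
  then obtain A' where A': "A' \<in> \<J>" "A = f ` A'" by blast
  {
    fix B assume "B \<subseteq> A"
    then obtain B' where "B' \<subseteq> A'" "B = f ` B'" using A' by (auto simp: subset_image_iff)
    then show "B \<in> (`) f ` \<J>" using assms(2) A' by (auto simp: ideal_on_def)
  next
    fix B assume "B \<in> (`) f ` \<J>"
    then obtain B' where "B' \<in> \<J>" "B = f ` B'" by blast
    then show "A \<union> B \<in> (`) f ` \<J>"
      using assms(2) A' by (auto simp: ideal_on_def image_Un[symmetric])
  }
next
  have T: "T = f ` S" and inj: "inj_on f S" using assms(1) by (auto simp: bij_betw_def)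
  fix F assume F: "F \<subseteq> T \<and> finite F"
  then obtain F' where "F' \<subseteq> S" "F = f ` F'" by (auto simp: subset_image_iff T)
  moreover from this have "finite F'" using F inj by (meson finite_imageD inj_on_subset)
  ultimately show "F \<in> (`) f ` \<J>" using assms(2) by (auto simp: ideal_on_def)
qed

text \<open>Injectivity on \<open>S\<close> makes images of subsets commute with intersections and
  reflect finiteness.\<close>

lemma image_mem_orth_ideal_iff:
  assumes "bij_betw f S T" "\<J> \<subseteq> Pow S" "B \<subseteq> S"
  shows "f ` B \<in> orth_ideal T ((`) f ` \<J>) \<longleftrightarrow> B \<in> orth_ideal S \<J>"
proof -
  have T: "T = f ` S" and inj: "inj_on f S" using assms(1) by (auto simp: bij_betw_def)
  have "finite (f ` A \<inter> f ` B) \<longleftrightarrow> finite (A \<inter> B)" if "A \<in> \<J>" for A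
  proof -
    have "A \<subseteq> S" using assms(2) that by blast
    then have "f ` A \<inter> f ` B = f ` (A \<inter> B)" "inj_on f (A \<inter> B)"
      using inj assms(3) by (auto simp: inj_on_image_Int intro: inj_on_subset)
    then show ?thesis by (simp add: finite_image_iff)
  qed
  then show ?thesis using assms(3) by (auto simp: orth_ideal_def T)
qed

section \<open>Splitting a bounded family into blocks\<close>

text \<open>\<open>Bcontfun\<close> is meaningful only on bounded continuous functions; on a
  discrete domain continuity is automatic, so a uniform bound suffices.\<close>

lemma apply_Bcontfun_discrete:
  fixes f :: "'i::discrete_topology \<Rightarrow> 'b::real_normed_vector"
  assumes "\<And>i. norm (f i) \<le> C"
  shows "apply_bcontfun (Bcontfun f) = f"
  by (rule Bcontfun_inverse, rule bcontfun_normI[OF _ assms]) simp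

text \<open>For a bijection \<open>f\<close> from \<open>S\<close> to a block, this is the
  restriction to that block in the coordinates of \<open>S\<close>; the value 0 off \<open>S\<close>
  matches the extension by zero in \<open>c0_ideal\<close>.\<close>

definition reindex ::
    "nat set \<Rightarrow> (nat \<Rightarrow> nat) \<Rightarrow> (nat \<Rightarrow>\<^sub>C 'a::real_normed_vector) \<Rightarrow> (nat \<Rightarrow>\<^sub>C 'a)" where
  "reindex S f x = Bcontfun (\<lambda>s. if s \<in> S then apply_bcontfun x (f s) else 0)"

lemma apply_reindex:
  "apply_bcontfun (reindex S f x) s = (if s \<in> S then apply_bcontfun x (f s) else 0)"
  unfolding reindex_def
  by (subst apply_Bcontfun_discrete[where C = "norm x"]) (auto simp: norm_bounded)

lemma norm_reindex_le: "norm (reindex S f x) \<le> norm x"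
  by (rule norm_bound) (auto simp: apply_reindex norm_bounded)

text \<open>The future isometry, defined on all bounded families; which of them land in the
  \<open>c0_sum\<close> is settled separately.\<close>

definition split_blocks ::
    "(nat \<Rightarrow> nat set) \<Rightarrow> (nat \<Rightarrow> nat \<Rightarrow> nat) \<Rightarrow> (nat \<Rightarrow>\<^sub>C 'a::real_normed_vector) \<Rightarrow>
      (nat \<Rightarrow>\<^sub>C (nat \<Rightarrow>\<^sub>C 'a))" where
  "split_blocks S f x = Bcontfun (\<lambda>j. reindex (S j) (f j) x)"

lemma apply_split_blocks:
  "apply_bcontfun (split_blocks S f x) j = reindex (S j) (f j) x"
  unfolding split_blocks_def
  by (subst apply_Bcontfun_discrete[where C = "norm x"]) (auto simp: norm_reindex_le)

lemma split_blocks_add: "split_blocks S f (x + y) = split_blocks S f x + split_blocks S f y"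
  by (intro bcontfun_eqI) (simp add: apply_split_blocks apply_reindex)

lemma split_blocks_scaleR: "split_blocks S f (c *\<^sub>R x) = c *\<^sub>R split_blocks S f x"
  by (intro bcontfun_eqI) (simp add: apply_split_blocks apply_reindex)

text \<open>The blocks cover the index set, so the supremum of the block suprema is the global
  supremum.\<close>

lemma norm_split_blocks:
  assumes K: "indexed_partition K" and f: "\<And>j. bij_betw (f j) (S j) (K j)"
  shows "norm (split_blocks S f x) = norm x"
proof (rule antisym)
  show "norm (split_blocks S f x) \<le> norm x"
    by (rule norm_bound) (simp add: apply_split_blocks norm_reindex_le)
  show "norm x \<le> norm (split_blocks S f x)"
  proof (rule norm_bound)
    fix n
    obtain j where "n \<in> K j" using indexed_partition_cover[OF K] .
    then obtain s where s: "s \<in> S j" "f j s = n"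
      using f[of j] by (metis bij_betw_imp_surj_on imageE)
    then have "apply_bcontfun x n = apply_bcontfun (reindex (S j) (f j) x) s"
      by (simp add: apply_reindex)
    also have "norm \<dots> \<le> norm (reindex (S j) (f j) x)" by (rule norm_bounded)
    also have "\<dots> \<le> norm (split_blocks S f x)"
      by (metis apply_split_blocks norm_bounded)
    finally show "norm (apply_bcontfun x n) \<le> norm (split_blocks S f x)" .
  qed
qed

text \<open>A preimage is glued together: its value at \<open>n\<close> is read from the one block
  containing \<open>n\<close>, through the inverse of the bijection of that block.\<close>

lemma surj_split_blocks:
  assumes K: "indexed_partition K" and f: "\<And>j. bij_betw (f j) (S j) (K j)"
    and y: "\<And>j s. s \<notin> S j \<Longrightarrow> apply_bcontfun (apply_bcontfun y j) s = 0"
  obtains x where "split_blocks S f x = y"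
proof -
  define k where "k n = (THE j. n \<in> K j)" for n
  have k: "k n = j" if "n \<in> K j" for n j
    unfolding k_def using that indexed_partition_disjoint[OF K] by blast
  define x where
    "x = Bcontfun (\<lambda>n. apply_bcontfun (apply_bcontfun y (k n)) (inv_into (S (k n)) (f (k n)) n))"
  have "norm (apply_bcontfun (apply_bcontfun y i) s) \<le> norm y" for i s
    by (meson norm_bounded order_trans)
  then have x: "apply_bcontfun x n =
      apply_bcontfun (apply_bcontfun y (k n)) (inv_into (S (k n)) (f (k n)) n)" for n
    unfolding x_def by (subst apply_Bcontfun_discrete[where C = "norm y"]) auto
  have "split_blocks S f x = y"
  proof (intro bcontfun_eqI)
    fix j s
    show "apply_bcontfun (apply_bcontfun (split_blocks S f x) j) s =
        apply_bcontfun (apply_bcontfun y j) s"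
    proof (cases "s \<in> S j")
      case True
      then have "f j s \<in> K j" "inv_into (S j) (f j) (f j s) = s"
        using f[of j] by (auto simp: bij_betw_def)
      then show ?thesis using True k by (simp add: apply_split_blocks apply_reindex x)
    qed (simp add: apply_split_blocks apply_reindex y)
  qed
  then show ?thesis by (rule that)
qed

text \<open>For each \<epsilon>, \<open>orth_ideal_sum_iff\<close> splits the condition on the level
  set of \<open>x\<close> into one condition per block and the finiteness of the set of blocks met;
  that finiteness for all \<epsilon> says that the block norms tend to 0.\<close>

lemma split_blocks_mem_iff:
  assumes K: "indexed_partition K" and f: "\<And>j. bij_betw (f j) (S j) (K j)"
    and \<J>: "\<And>j. ideal_on (S j) (\<J> j)"
  shows "split_blocks S f x \<in> c0_sum (\<lambda>j. c0_ideal (S j) (orth_ideal (S j) (\<J> j))) \<longleftrightarrow>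
    x \<in> c0_ideal UNIV (orth_ideal UNIV (ideal_sum K (\<lambda>j. (`) (f j) ` \<J> j)))"
proof -
  define B where "B \<epsilon> = {n. norm (apply_bcontfun x n) \<ge> \<epsilon>}" for \<epsilon>
  \<comment> \<open>The part of the level set \<open>B \<epsilon>\<close> in block
    \<open>K j\<close>, in the coordinates of \<open>S j\<close>.\<close>
  define D where "D \<epsilon> j = {s \<in> S j. norm (apply_bcontfun x (f j s)) \<ge> \<epsilon>}" for \<epsilon> j
  have BD: "B \<epsilon> \<inter> K j = f j ` D \<epsilon> j" for \<epsilon> j
    using f[of j] by (auto simp: B_def D_def bij_betw_def)
  have "(\<lambda>j. norm (reindex (S j) (f j) x)) \<longlonglongrightarrow> 0 \<longleftrightarrow> (\<forall>\<epsilon>>0. finite {j. D \<epsilon> j \<noteq> {}})"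
    (is "?lim \<longleftrightarrow> ?fin")
  proof
    assume ?lim
    show ?fin
    proof (intro allI impI)
      fix \<epsilon> :: real assume "\<epsilon> > 0"
      with \<open>?lim\<close> have "eventually (\<lambda>j. norm (reindex (S j) (f j) x) < \<epsilon>) sequentially"
        by (rule order_tendstoD(2))
      then have "finite {j. \<not> norm (reindex (S j) (f j) x) < \<epsilon>}"
        by (simp add: cofinite_eq_sequentially[symmetric] eventually_cofinite)
      moreover have "{j. D \<epsilon> j \<noteq> {}} \<subseteq> {j. \<not> norm (reindex (S j) (f j) x) < \<epsilon>}"
      proof clarsimp
        fix j assume lt: "norm (reindex (S j) (f j) x) < \<epsilon>" and "D \<epsilon> j \<noteq> {}"
        then obtain s where "s \<in> S j" "\<epsilon> \<le> norm (apply_bcontfun x (f j s))"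
          by (auto simp: D_def)
        then show False using lt norm_bounded[of "reindex (S j) (f j) x" s]
          by (simp add: apply_reindex)
      qed
      ultimately show "finite {j. D \<epsilon> j \<noteq> {}}" by (rule rev_finite_subset)
    qed
  next
    assume fin: ?fin
    show ?lim
    proof (rule order_tendstoI)
      fix \<epsilon> :: real assume "\<epsilon> > 0"
      \<comment> \<open>Entries below a bound only give a supremum at most that bound; halving
        \<epsilon> restores the strict inequality.\<close>
      have "norm (reindex (S j) (f j) x) < \<epsilon>" if "D (\<epsilon>/2) j = {}" for j
      proof -
        have "norm (reindex (S j) (f j) x) \<le> \<epsilon>/2"
          by (rule norm_bound) (use that \<open>\<epsilon> > 0\<close> in \<open>force simp: D_def apply_reindex\<close>)
        then show ?thesis using \<open>\<epsilon> > 0\<close> by simp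
      qed
      then have "{j. \<not> norm (reindex (S j) (f j) x) < \<epsilon>} \<subseteq> {j. D (\<epsilon>/2) j \<noteq> {}}" by blast
      moreover have "finite {j. D (\<epsilon>/2) j \<noteq> {}}" using fin \<open>\<epsilon> > 0\<close> by simp
      ultimately have "finite {j. \<not> norm (reindex (S j) (f j) x) < \<epsilon>}"
        by (rule finite_subset)
      then show "eventually (\<lambda>j. norm (reindex (S j) (f j) x) < \<epsilon>) sequentially"
        by (simp add: cofinite_eq_sequentially[symmetric] eventually_cofinite)
    next
      fix \<epsilon> :: real assume "\<epsilon> < 0"
      then show "eventually (\<lambda>j. \<epsilon> < norm (reindex (S j) (f j) x)) sequentially"
        by (intro always_eventually allI) (rule less_le_trans[OF _ norm_ge_zero])
    qed
  qed
  moreover have "reindex (S j) (f j) x \<in> c0_ideal (S j) (orth_ideal (S j) (\<J> j)) \<longleftrightarrow>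
      (\<forall>\<epsilon>>0. D \<epsilon> j \<in> orth_ideal (S j) (\<J> j))" for j
    by (simp add: c0_ideal_def D_def apply_reindex cong: conj_cong)
  moreover have "B \<epsilon> \<in> orth_ideal UNIV (ideal_sum K (\<lambda>j. (`) (f j) ` \<J> j)) \<longleftrightarrow>
      finite {j. D \<epsilon> j \<noteq> {}} \<and> (\<forall>j. D \<epsilon> j \<in> orth_ideal (S j) (\<J> j))" for \<epsilon>
  proof -
    have "f j ` D \<epsilon> j \<in> orth_ideal (K j) ((`) (f j) ` \<J> j) \<longleftrightarrow> D \<epsilon> j \<in> orth_ideal (S j) (\<J> j)" for j
      using \<J>[of j] by (intro image_mem_orth_ideal_iff f) (auto simp: ideal_on_def D_def)
    then show ?thesis
      by (simp add: orth_ideal_sum_iff[OF K ideal_on_image[OF f \<J>]] BD)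
  qed
  ultimately show ?thesis
    by (auto simp: c0_sum_def apply_split_blocks c0_ideal_def[of UNIV] simp flip: B_def)
qed

text \<open>Identity bijections will give the first claim, \<open>S j = UNIV\<close> with a constant
  ideal the second.\<close>

lemma isometric_c0_ideal_c0_sum:
  assumes K: "indexed_partition K" and f: "\<And>j. bij_betw (f j) (S j) (K j)"
    and \<J>: "\<And>j. ideal_on (S j) (\<J> j)"
  shows "isometric_spaces
    (c0_ideal UNIV (orth_ideal UNIV (ideal_sum K (\<lambda>j. (`) (f j) ` \<J> j))) :: (nat \<Rightarrow>\<^sub>C 'a::banach) set)
    (c0_sum (\<lambda>j. c0_ideal (S j) (orth_ideal (S j) (\<J> j)) :: (nat \<Rightarrow>\<^sub>C 'a) set))"
    (is "isometric_spaces ?V ?W")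
  unfolding isometric_spaces_def
proof (intro exI[of _ "split_blocks S f"] conjI)
  show "split_blocks S f ` ?V = ?W"
  proof
    show "split_blocks S f ` ?V \<subseteq> ?W"
      using split_blocks_mem_iff[OF K f \<J>] by blast
    show "?W \<subseteq> split_blocks S f ` ?V"
    proof
      fix y assume y: "y \<in> ?W"
      then have "apply_bcontfun (apply_bcontfun y j) s = 0" if "s \<notin> S j" for j s
        using that by (auto simp: c0_sum_def c0_ideal_def)
      then obtain x where "split_blocks S f x = y" using surj_split_blocks[OF K f] by metis
      \<comment> \<open>Membership is an equivalence, so the preimage \<open>x\<close> is already in
        \<open>?V\<close>.\<close>
      then show "y \<in> split_blocks S f ` ?V"
        using y split_blocks_mem_iff[OF K f \<J>] by blast
    qed
  qed
qed (simp_all add: split_blocks_add split_blocks_scaleR norm_split_blocks[OF K f])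

theorem theorem5p4:
  "(\<forall>(K :: nat \<Rightarrow> nat set) (\<I> :: nat \<Rightarrow> nat set set).
      indexed_partition K \<and> (\<forall>n. ideal_on (K n) (\<I> n)) \<longrightarrow>
      isometric_spaces
        (c0_ideal UNIV (orth_ideal UNIV (ideal_sum K \<I>)) :: (nat \<Rightarrow>\<^sub>C 'a::banach) set)
        (c0_sum (\<lambda>j. c0_ideal (K j) (orth_ideal (K j) (\<I> j)) :: (nat \<Rightarrow>\<^sub>C 'a) set)))
   \<and>
   (\<forall>(\<J> :: nat set set) (\<J>\<omega> :: nat set set).
      ideal_on UNIV \<J> \<and> omega_power \<J> \<J>\<omega> \<longrightarrow>
      isometric_spaces
        (c0_ideal UNIV (orth_ideal UNIV \<J>\<omega>) :: (nat \<Rightarrow>\<^sub>C 'a) set)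
        (c0_sum (\<lambda>j. c0_ideal UNIV (orth_ideal UNIV \<J>) :: (nat \<Rightarrow>\<^sub>C 'a) set)))"
proof (intro conjI allI impI)
  fix K :: "nat \<Rightarrow> nat set" and \<I> :: "nat \<Rightarrow> nat set set"
  assume "indexed_partition K \<and> (\<forall>n. ideal_on (K n) (\<I> n))"
  then show "isometric_spaces
      (c0_ideal UNIV (orth_ideal UNIV (ideal_sum K \<I>)) :: (nat \<Rightarrow>\<^sub>C 'a) set)
      (c0_sum (\<lambda>j. c0_ideal (K j) (orth_ideal (K j) (\<I> j)) :: (nat \<Rightarrow>\<^sub>C 'a) set))"
    \<comment> \<open>With \<open>S = K\<close> and identity maps, each image ideal reduces to
      \<open>\<I> j\<close>.\<close>
    using isometric_c0_ideal_c0_sum[of K "\<lambda>_ s. s" K \<I>] by (simp add: bij_betw_def)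
next
  fix \<J> \<J>\<omega> :: "nat set set"
  assume *: "ideal_on UNIV \<J> \<and> omega_power \<J> \<J>\<omega>"
  then obtain K \<J>' where K: "indexed_partition K" and copy: "\<And>n. ideal_copy \<J> (K n) (\<J>' n)"
    and \<J>\<omega>: "\<J>\<omega> = ideal_sum K \<J>'"
    by (auto simp: omega_power_def)
  \<comment> \<open>One bijection per copy, chosen for all blocks simultaneously.\<close>
  obtain f where f: "\<And>n. bij_betw (f n) UNIV (K n)" and \<J>': "\<And>n. \<J>' n = (`) (f n) ` \<J>"
    using copy unfolding ideal_copy_def by metis
  have "\<J>\<omega> = ideal_sum K (\<lambda>j. (`) (f j) ` \<J>)"
    by (simp add: \<J>\<omega> \<J>'[abs_def])
  then show "isometric_spaces
      (c0_ideal UNIV (orth_ideal UNIV \<J>\<omega>) :: (nat \<Rightarrow>\<^sub>C 'a) set)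
      (c0_sum (\<lambda>j. c0_ideal UNIV (orth_ideal UNIV \<J>) :: (nat \<Rightarrow>\<^sub>C 'a) set))"
    using isometric_c0_ideal_c0_sum[of K f "\<lambda>_. UNIV" "\<lambda>_. \<J>"] K f * by simp
qed

end
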